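(* Let $n\ge 4$ and let $\operatorname{SD}_{2^n}=\langle a,b\mid a^{2^{n-1}}=b^2=1,\ bab=a^{2^{n-2}-1}\rangle$ be the semidihedral group of order $2^n$. Then \[ c(\operatorname{SD}_{2^n})\ge\left\lfloor\frac{5(n-1)}{2}\right\rfloor=\begin{cases}5m-3 & n=2m,\\ 5m & n=2m+1.\end{cases}\]
   Context: For a finite group $G$, a $G$-transfer system is a partial order $\to$ on the set $\operatorname{Sub}(G)$ of subgroups of $G$ such that: (i) $K\to H$ implies $K\le H$; (ii) $H\to H$ for all $H$; (iii) $L\to K$ and $K\to H$ imply $L\to H$; (iv) $K\to H$ and $L\le H$ imply $K\cap L\to H\cap L$; (v) $K\to H$ implies $gKg^{-1}\to gHg^{-1}$ for all $g\in G$. Let $\operatorname{Tr}(G)$ be the set of $G$-transfer systems. For a set $S$ of pairs $(K,H)$ with $K\le H$, $\langle S\rangle$ denotes the smallest transfer system containing $S$. A minimal generating set of $T\in\operatorname{Tr}(G)$ is a set $S$ with $\langle S\rangle=T$ such that no $a\in S$ lies in $\langle S\setminus\{a\}\rangle$. All minimal generating sets of a given $T$ have the same size $m(T)$, and the complexity is $c(G)=\max\{m(T)\mid T\in\operatorname{Tr}(G)\}$. *)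

theory Defs
  imports Complex_Main "HOL-Algebra.Algebra"
begin

section \<open>Transfer systems\<close>

definition subgroups :: "('a, 'm) monoid_scheme \<Rightarrow> 'a set set" where
  "subgroups G = {H. subgroup H G}"

definition conj_subgroup :: "('a, 'm) monoid_scheme \<Rightarrow> 'a \<Rightarrow> 'a set \<Rightarrow> 'a set" where
  "conj_subgroup G g H = g <#\<^bsub>G\<^esub> H #>\<^bsub>G\<^esub> inv\<^bsub>G\<^esub> g"

text \<open>A pair \<open>(K, H) \<in> T\<close> stands for \<open>K \<rightarrow> H\<close>. Reflexivity and transitivity of transfer
  systems are part of \<open>partial_order_on\<close>.\<close>

definition transfer_system :: "('a, 'm) monoid_scheme \<Rightarrow> ('a set \<times> 'a set) set \<Rightarrow> bool" where
  "transfer_system G T \<longleftrightarrow>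
     partial_order_on (subgroups G) T \<and>
     (\<forall>K H. (K, H) \<in> T \<longrightarrow> K \<subseteq> H) \<and>
     (\<forall>K H L. (K, H) \<in> T \<and> L \<in> subgroups G \<and> L \<subseteq> H \<longrightarrow> (K \<inter> L, H \<inter> L) \<in> T) \<and>
     (\<forall>K H. \<forall>g \<in> carrier G. (K, H) \<in> T \<longrightarrow> (conj_subgroup G g K, conj_subgroup G g H) \<in> T)"

definition Tr :: "('a, 'm) monoid_scheme \<Rightarrow> ('a set \<times> 'a set) set set" where
  "Tr G = {T. transfer_system G T}"

definition subgroup_pairs :: "('a, 'm) monoid_scheme \<Rightarrow> ('a set \<times> 'a set) set" where
  "subgroup_pairs G = {(K, H). K \<in> subgroups G \<and> H \<in> subgroups G \<and> K \<subseteq> H}"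

definition ts_generated :: "('a, 'm) monoid_scheme \<Rightarrow> ('a set \<times> 'a set) set \<Rightarrow> ('a set \<times> 'a set) set" where
  "ts_generated G S = \<Inter>{T \<in> Tr G. S \<subseteq> T}"

definition minimal_generating_set ::
  "('a, 'm) monoid_scheme \<Rightarrow> ('a set \<times> 'a set) set \<Rightarrow> ('a set \<times> 'a set) set \<Rightarrow> bool" where
  "minimal_generating_set G T S \<longleftrightarrow>
     S \<subseteq> subgroup_pairs G \<and> ts_generated G S = T \<and> (\<forall>x \<in> S. x \<notin> ts_generated G (S - {x}))"

text \<open>For finite \<open>G\<close>, all minimal generating sets of \<open>T\<close> have the same size, so the definite
  description below is meaningful; \<open>Tr G\<close> is then finite and nonempty, so \<open>Max\<close> is too.\<close>

definition min_gen_size :: "('a, 'm) monoid_scheme \<Rightarrow> ('a set \<times> 'a set) set \<Rightarrow> nat" where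
  "min_gen_size G T = (THE k. \<exists>S. minimal_generating_set G T S \<and> card S = k)"

definition complexity :: "('a, 'm) monoid_scheme \<Rightarrow> nat" where
  "complexity G = Max {min_gen_size G T | T. T \<in> Tr G}"

text \<open>The family intersected in \<open>ts_generated\<close> is nonempty whenever \<open>S \<subseteq> subgroup_pairs G\<close>,
  and the intersection is a transfer system.\<close>

lemma (in group) conj_subgroup_subgroup:
  assumes "g \<in> carrier G" "H \<in> subgroups G"
  shows "conj_subgroup G g H \<in> subgroups G"
  using subgroup_conjugation_is_surj2[of g H] assms
  by (simp add: subgroups_def conj_subgroup_def)

lemma (in group) subgroup_pairs_transfer_system: "transfer_system G (subgroup_pairs G)"
proof -
  have "K \<inter> L \<in> subgroups G" if "K \<in> subgroups G" "L \<in> subgroups G" for K L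
    using that subgroups_Inter_pair by (simp add: subgroups_def)
  moreover have "conj_subgroup G g K \<subseteq> conj_subgroup G g H" if "K \<subseteq> H" for g K H
    using that by (auto simp: conj_subgroup_def l_coset_def r_coset_def)
  moreover have "partial_order_on (subgroups G) (subgroup_pairs G)"
    unfolding order_on_defs subgroup_pairs_def refl_on_def trans_def antisym_def by auto
  ultimately show ?thesis
    using conj_subgroup_subgroup unfolding transfer_system_def subgroup_pairs_def by auto
qed

lemma (in group) ts_generated_transfer_system:
  assumes "S \<subseteq> subgroup_pairs G"
  shows "ts_generated G S \<in> Tr G"
proof -
  have "subgroup_pairs G \<in> {T \<in> Tr G. S \<subseteq> T}"
    using assms subgroup_pairs_transfer_system by (simp add: Tr_def)
  then have sub: "ts_generated G S \<subseteq> subgroup_pairs G"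
    unfolding ts_generated_def by blast
  have ts: "transfer_system G T" if "T \<in> {T \<in> Tr G. S \<subseteq> T}" for T
    using that by (simp add: Tr_def)
  have "partial_order_on (subgroups G) (ts_generated G S)"
    unfolding order_on_defs
  proof (intro conjI)
    show "ts_generated G S \<subseteq> subgroups G \<times> subgroups G"
      using sub by (auto simp: subgroup_pairs_def)
    show "refl_on (subgroups G) (ts_generated G S)"
      using ts by (simp add: ts_generated_def transfer_system_def order_on_defs refl_on_def)
    show "trans (ts_generated G S)"
    proof (rule transI)
      fix K H L assume "(K, H) \<in> ts_generated G S" "(H, L) \<in> ts_generated G S"
      moreover have "trans T" if "T \<in> {T \<in> Tr G. S \<subseteq> T}" for T
        using ts[OF that] by (simp add: transfer_system_def order_on_defs)
      ultimately show "(K, L) \<in> ts_generated G S"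
        unfolding ts_generated_def by (meson InterD InterI transD)
    qed
    show "antisym (ts_generated G S)"
      using sub by (auto simp: subgroup_pairs_def intro!: antisymI)
  qed
  moreover have "\<forall>K H. (K, H) \<in> ts_generated G S \<longrightarrow> K \<subseteq> H"
    using sub by (auto simp: subgroup_pairs_def)
  moreover have "(K \<inter> L, H \<inter> L) \<in> ts_generated G S"
    if "(K, H) \<in> ts_generated G S" "L \<in> subgroups G" "L \<subseteq> H" for K H L
    using that ts unfolding ts_generated_def transfer_system_def by simp
  moreover have "(conj_subgroup G g K, conj_subgroup G g H) \<in> ts_generated G S"
    if "(K, H) \<in> ts_generated G S" "g \<in> carrier G" for K H g
    using that ts unfolding ts_generated_def transfer_system_def by simp
  ultimately show ?thesis
    by (simp add: Tr_def transfer_system_def)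
qed


section \<open>Groups given by generators and relations\<close>

text \<open>A word is a list of letters \<open>(x, True)\<close> for the generator \<open>x\<close> and \<open>(x, False)\<close> for its
  formal inverse. A relation \<open>u = v\<close> is a pair of words. The generators are all elements
  of the type \<open>'g\<close>.\<close>

type_synonym 'g word = "('g \<times> bool) list"

inductive word_eq :: "('g word \<times> 'g word) set \<Rightarrow> 'g word \<Rightarrow> 'g word \<Rightarrow> bool"
  for R :: "('g word \<times> 'g word) set" where
  refl: "word_eq R u u"
| sym: "word_eq R u v \<Longrightarrow> word_eq R v u"
| trans: "word_eq R u v \<Longrightarrow> word_eq R v w \<Longrightarrow> word_eq R u w"
| append: "word_eq R u u' \<Longrightarrow> word_eq R v v' \<Longrightarrow> word_eq R (u @ v) (u' @ v')"
| cancel: "word_eq R [(x, e), (x, \<not> e)] []"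
| relation: "(u, v) \<in> R \<Longrightarrow> word_eq R u v"

definition word_class :: "('g word \<times> 'g word) set \<Rightarrow> 'g word \<Rightarrow> 'g word set" where
  "word_class R u = {v. word_eq R u v}"

definition presented_group :: "('g word \<times> 'g word) set \<Rightarrow> 'g word set monoid" where
  "presented_group R =
     \<lparr> carrier = range (word_class R),
       monoid.mult = (\<lambda>A B. \<Union>u \<in> A. \<Union>v \<in> B. word_class R (u @ v)),
       one = word_class R [] \<rparr>"

lemma word_class_eq_iff: "word_class R u = word_class R v \<longleftrightarrow> word_eq R u v"
proof
  assume "word_class R u = word_class R v"
  then have "v \<in> word_class R u" by (simp add: word_class_def word_eq.refl)
  then show "word_eq R u v" by (simp add: word_class_def)
next
  assume "word_eq R u v"
  then have "word_eq R u w \<longleftrightarrow> word_eq R v w" for w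
    by (meson word_eq.sym word_eq.trans)
  then show "word_class R u = word_class R v" by (simp add: word_class_def)
qed

lemma presented_group_mult:
  "word_class R u \<otimes>\<^bsub>presented_group R\<^esub> word_class R v = word_class R (u @ v)"
proof -
  have "word_class R (u' @ v') = word_class R (u @ v)"
    if "u' \<in> word_class R u" "v' \<in> word_class R v" for u' v'
    using that unfolding word_class_eq_iff
    by (metis mem_Collect_eq word_class_def word_eq.append word_eq.sym)
  moreover have "u \<in> word_class R u" "v \<in> word_class R v"
    by (simp_all add: word_class_def word_eq.refl)
  ultimately have "(\<Union>u' \<in> word_class R u. \<Union>v' \<in> word_class R v. word_class R (u' @ v')) =
      word_class R (u @ v)"
    by blast
  then show ?thesis
    by (simp add: presented_group_def)
qed

lemma word_eq_inverse: "word_eq R (rev (map (apsnd Not) u) @ u) []"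
proof (induction u)
  case Nil
  then show ?case by (simp add: word_eq.refl)
next
  case (Cons l u)
  obtain x e where l: "l = (x, e)" by fastforce
  have "word_eq R ([(x, \<not> e), (x, \<not> \<not> e)] @ u) ([] @ u)"
    by (intro word_eq.append word_eq.cancel word_eq.refl)
  then have "word_eq R (rev (map (apsnd Not) u) @ [(x, \<not> e), (x, e)] @ u)
      (rev (map (apsnd Not) u) @ u)"
    by (intro word_eq.append word_eq.refl) simp
  then show ?case
    using word_eq.trans[OF _ Cons.IH] by (simp add: l)
qed

lemma presented_group_is_group: "group (presented_group R)"
proof (rule groupI)
  fix A assume "A \<in> carrier (presented_group R)"
  then obtain u where u: "A = word_class R u" by (auto simp: presented_group_def)
  have "word_class R (rev (map (apsnd Not) u)) \<otimes>\<^bsub>presented_group R\<^esub> A = \<one>\<^bsub>presented_group R\<^esub>"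
    unfolding u presented_group_mult by (simp add: presented_group_def word_class_eq_iff word_eq_inverse)
  then show "\<exists>B \<in> carrier (presented_group R). B \<otimes>\<^bsub>presented_group R\<^esub> A = \<one>\<^bsub>presented_group R\<^esub>"
    by (auto simp: presented_group_def)
next
  show "\<one>\<^bsub>presented_group R\<^esub> \<in> carrier (presented_group R)"
    by (simp add: presented_group_def)
next
  fix A B assume "A \<in> carrier (presented_group R)" "B \<in> carrier (presented_group R)"
  then obtain u v where "A = word_class R u" "B = word_class R v"
    by (auto simp: presented_group_def)
  then show "A \<otimes>\<^bsub>presented_group R\<^esub> B \<in> carrier (presented_group R)"
    by (simp add: presented_group_mult) (simp add: presented_group_def)
next
  fix A B C
  assume "A \<in> carrier (presented_group R)" "B \<in> carrier (presented_group R)"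
    "C \<in> carrier (presented_group R)"
  then obtain u v w where "A = word_class R u" "B = word_class R v" "C = word_class R w"
    by (auto simp: presented_group_def)
  then show "A \<otimes>\<^bsub>presented_group R\<^esub> B \<otimes>\<^bsub>presented_group R\<^esub> C =
      A \<otimes>\<^bsub>presented_group R\<^esub> (B \<otimes>\<^bsub>presented_group R\<^esub> C)"
    by (simp add: presented_group_mult)
next
  fix A assume "A \<in> carrier (presented_group R)"
  then obtain u where u: "A = word_class R u" by (auto simp: presented_group_def)
  have "\<one>\<^bsub>presented_group R\<^esub> = word_class R []" by (simp add: presented_group_def)
  then show "\<one>\<^bsub>presented_group R\<^esub> \<otimes>\<^bsub>presented_group R\<^esub> A = A"
    by (simp add: u presented_group_mult)
qed


section \<open>The semidihedral group\<close>

datatype sd_gen = Gen_a | Gen_b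

abbreviation word_a :: "sd_gen word" where "word_a \<equiv> [(Gen_a, True)]"
abbreviation word_b :: "sd_gen word" where "word_b \<equiv> [(Gen_b, True)]"

abbreviation word_power :: "'g word \<Rightarrow> nat \<Rightarrow> 'g word" where
  "word_power u k \<equiv> concat (replicate k u)"

text \<open>\<open>SD n\<close> is the group of order \<open>2 ^ n\<close>, for \<open>n \<ge> 4\<close>; the subtractions are then not truncated.\<close>

definition SD :: "nat \<Rightarrow> sd_gen word set monoid" where
  "SD n = presented_group
     {(word_power word_a (2 ^ (n - 1)), []),
      (word_power word_b 2, []),
      (word_b @ word_a @ word_b, word_power word_a (2 ^ (n - 2) - 1))}"

end

theory Submission
  imports Defs "HOL-Number_Theory.Cong"
begin

text \<open>Exchange: if \<open>(K, H)\<close> is an element of a minimal generating set \<open>S\<close>, \<open>A\<close> is the rest of \<open>S\<close>, and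
  \<open>S'\<close> generates the same transfer system, then every transfer that is not generated by \<open>A\<close> has a
  source of order at most \<open>\<bar>K\<bar>\<close>. In a chain of restrictions of conjugates of \<open>S'\<close> from \<open>K\<close> to \<open>H\<close>
  only the first step can thus lie outside \<open>\<langle>A\<rangle>\<close>, and \<open>(K, H)\<close> can be replaced by one element of \<open>S'\<close>.
  Hence minimal generating sets are equinumerous, and any independent set bounds the complexity
  from below.

  Independence: for a conjugation invariant family \<open>P\<close> of subgroups, the pairs \<open>(L, M)\<close> such that
  \<open>P (N \<inter> L)\<close> implies \<open>P N\<close> for all \<open>N \<le> M\<close> form a transfer system. A set of pairs is therefore
  independent if each \<open>(K, H)\<close> in it has such a family with \<open>P K\<close> and \<open>\<not> P H\<close> whose transfer system
  contains all other pairs.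

  Let \<open>h = (n - 1) div 2\<close>, and let \<open>C\<^sub>i\<close>, \<open>D\<^sub>i\<close>, \<open>Q\<^sub>i\<close> be the cyclic rotation, dihedral and quaternion
  subgroups of order \<open>2 ^ i\<close>. The independent set consists of the transfers from \<open>C\<^sub>i\<close> to the subgroups
  of order \<open>2 ^ (2 * h + 1 - i)\<close> of each type, for \<open>i \<le> h\<close>, of \<open>D\<^sub>j \<rightarrow> D\<^sub>j\<^sub>+\<^sub>1\<close> for \<open>1 \<le> j \<le> h\<close>, and of
  \<open>Q\<^sub>j \<rightarrow> Q\<^sub>j\<^sub>+\<^sub>1\<close> for \<open>2 \<le> j \<le> h\<close>.\<close>

section \<open>Transfer systems and minimal generating sets\<close>

lemma conj_subgroup_image: "conj_subgroup G g H = (\<lambda>x. g \<otimes>\<^bsub>G\<^esub> x \<otimes>\<^bsub>G\<^esub> inv\<^bsub>G\<^esub> g) ` H"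
  by (auto simp: conj_subgroup_def l_coset_def r_coset_def)

context group
begin

lemma conj_subgroup_conj_subgroup:
  assumes "H \<subseteq> carrier G" "g \<in> carrier G" "h \<in> carrier G"
  shows "conj_subgroup G g (conj_subgroup G h H) = conj_subgroup G (g \<otimes> h) H"
  unfolding conj_subgroup_image image_image
  using assms by (intro image_cong) (auto simp: subset_iff m_assoc inv_mult_group)

lemma conj_subgroup_one: "H \<subseteq> carrier G \<Longrightarrow> conj_subgroup G \<one> H = H"
  unfolding conj_subgroup_image by (force simp: subset_iff)

lemma conj_subgroup_inv:
  assumes "H \<subseteq> carrier G" "g \<in> carrier G"
  shows "conj_subgroup G (inv g) (conj_subgroup G g H) = H"
    and "conj_subgroup G g (conj_subgroup G (inv g) H) = H"
  using assms by (simp_all add: conj_subgroup_conj_subgroup conj_subgroup_one)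

lemma inj_on_conj: "g \<in> carrier G \<Longrightarrow> inj_on (\<lambda>x. g \<otimes> x \<otimes> inv g) (carrier G)"
  by (intro inj_onI) simp

lemma conj_subgroup_Int:
  assumes "H \<subseteq> carrier G" "K \<subseteq> carrier G" "g \<in> carrier G"
  shows "conj_subgroup G g (H \<inter> K) = conj_subgroup G g H \<inter> conj_subgroup G g K"
  unfolding conj_subgroup_image using inj_on_image_Int[OF inj_on_conj] assms by blast

lemma conj_subgroup_mono: "H \<subseteq> K \<Longrightarrow> conj_subgroup G g H \<subseteq> conj_subgroup G g K"
  unfolding conj_subgroup_image by blast

lemma card_conj_subgroup:
  assumes "H \<subseteq> carrier G" "g \<in> carrier G"
  shows "card (conj_subgroup G g H) = card H"
  unfolding conj_subgroup_image
  by (rule card_image) (rule inj_on_subset[OF inj_on_conj assms(1)], fact)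

lemma subgroups_carrier: "H \<in> subgroups G \<Longrightarrow> H \<subseteq> carrier G"
  by (simp add: subgroups_def subgroup.subset)

lemma subgroups_Int: "H \<in> subgroups G \<Longrightarrow> K \<in> subgroups G \<Longrightarrow> H \<inter> K \<in> subgroups G"
  using subgroups_Inter_pair by (simp add: subgroups_def)

lemma transfer_systemI:
  assumes "T \<subseteq> subgroup_pairs G"
    and "\<And>H. H \<in> subgroups G \<Longrightarrow> (H, H) \<in> T"
    and "\<And>L K H. (L, K) \<in> T \<Longrightarrow> (K, H) \<in> T \<Longrightarrow> (L, H) \<in> T"
    and "\<And>K H L. (K, H) \<in> T \<Longrightarrow> L \<in> subgroups G \<Longrightarrow> L \<subseteq> H \<Longrightarrow> (K \<inter> L, L) \<in> T"
    and "\<And>K H g. (K, H) \<in> T \<Longrightarrow> g \<in> carrier G \<Longrightarrow>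
      (conj_subgroup G g K, conj_subgroup G g H) \<in> T"
  shows "T \<in> Tr G"
proof -
  have "trans T" by (rule transI) (rule assms(3))
  moreover have "antisym T" "refl_on (subgroups G) T" "T \<subseteq> subgroups G \<times> subgroups G"
    using assms(1,2) by (auto simp: subgroup_pairs_def refl_on_def intro!: antisymI)
  ultimately have "partial_order_on (subgroups G) T" by (simp add: order_on_defs)
  moreover have "(K \<inter> L, H \<inter> L) \<in> T" if "(K, H) \<in> T" "L \<in> subgroups G" "L \<subseteq> H" for K H L
    using assms(4)[OF that] that(3) by (simp add: inf.absorb2)
  ultimately show ?thesis
    using assms(1,5) by (auto simp: Tr_def transfer_system_def subgroup_pairs_def)
qed

lemma transfer_systemD:
  assumes "T \<in> Tr G"
  shows "T \<subseteq> subgroup_pairs G"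
    and "H \<in> subgroups G \<Longrightarrow> (H, H) \<in> T"
    and "(L, K) \<in> T \<Longrightarrow> (K, H) \<in> T \<Longrightarrow> (L, H) \<in> T"
    and "(K, H) \<in> T \<Longrightarrow> L \<in> subgroups G \<Longrightarrow> L \<subseteq> H \<Longrightarrow> (K \<inter> L, L) \<in> T"
    and "(K, H) \<in> T \<Longrightarrow> g \<in> carrier G \<Longrightarrow> (conj_subgroup G g K, conj_subgroup G g H) \<in> T"
proof -
  have po: "partial_order_on (subgroups G) T" and ts: "transfer_system G T"
    using assms by (auto simp: Tr_def transfer_system_def)
  show "T \<subseteq> subgroup_pairs G"
    using po ts unfolding order_on_defs transfer_system_def subgroup_pairs_def by auto
  show "H \<in> subgroups G \<Longrightarrow> (H, H) \<in> T"
    using po unfolding order_on_defs refl_on_def by blast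
  show "(L, K) \<in> T \<Longrightarrow> (K, H) \<in> T \<Longrightarrow> (L, H) \<in> T"
    using po unfolding order_on_defs by (meson transD)
  show "(K \<inter> L, L) \<in> T" if "(K, H) \<in> T" "L \<in> subgroups G" "L \<subseteq> H"
  proof -
    have "(K \<inter> L, H \<inter> L) \<in> T" using ts that unfolding transfer_system_def by blast
    then show ?thesis using that(3) by (simp add: inf.absorb2)
  qed
  show "(K, H) \<in> T \<Longrightarrow> g \<in> carrier G \<Longrightarrow> (conj_subgroup G g K, conj_subgroup G g H) \<in> T"
    using ts unfolding transfer_system_def by blast
qed

section \<open>Generated transfer systems and the exchange property\<close>

lemma ts_generated_least: "T \<in> Tr G \<Longrightarrow> S \<subseteq> T \<Longrightarrow> ts_generated G S \<subseteq> T"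
  unfolding ts_generated_def by blast

lemma ts_generated_superset: "S \<subseteq> ts_generated G S"
  unfolding ts_generated_def by blast

lemma ts_generated_mono: "S \<subseteq> S' \<Longrightarrow> ts_generated G S \<subseteq> ts_generated G S'"
  unfolding ts_generated_def by blast

text \<open>The pairs of \<open>ts_generated G A\<close> together with all pairs whose source has
  order at most \<open>card K\<close> form a transfer system: restriction and conjugation do not
  enlarge a source, and the source of a composite is contained in the sources of both steps.\<close>

lemma card_source_le_of_new_pair:
  assumes fin: "finite (carrier G)"
    and A: "insert (K, H) A \<subseteq> subgroup_pairs G"
    and p: "(L, M) \<in> ts_generated G (insert (K, H) A)" "(L, M) \<notin> ts_generated G A"
  shows "card L \<le> card K"
proof -
  let ?T = "ts_generated G A"
  define U where "U = {(L, M) \<in> subgroup_pairs G. (L, M) \<in> ?T \<or> card L \<le> card K}"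
  have T: "?T \<in> Tr G" using A by (intro ts_generated_transfer_system) auto
  note TD = transfer_systemD[OF T]
  have finH: "finite H" if "H \<in> subgroups G" for H
    using that fin subgroups_carrier finite_subset by blast
  have "U \<in> Tr G"
  proof (rule transfer_systemI)
    show "U \<subseteq> subgroup_pairs G" by (auto simp: U_def)
    show "(H, H) \<in> U" if "H \<in> subgroups G" for H
      using that TD(2) by (auto simp: U_def subgroup_pairs_def)
    show "(L, N) \<in> U" if "(L, M) \<in> U" "(M, N) \<in> U" for L M N
    proof -
      have "card L \<le> card M"
        using that finH by (auto simp: U_def subgroup_pairs_def intro!: card_mono)
      then show ?thesis
        using that TD(3)[of L M N] by (auto simp: U_def subgroup_pairs_def)
    qed
    show "(L \<inter> N, N) \<in> U" if "(L, M) \<in> U" "N \<in> subgroups G" "N \<subseteq> M" for L M N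
    proof -
      have "card (L \<inter> N) \<le> card L"
        using that finH by (auto simp: U_def subgroup_pairs_def intro!: card_mono)
      then show ?thesis
        using that TD(4)[of L M N] subgroups_Int by (auto simp: U_def subgroup_pairs_def)
    qed
    show "(conj_subgroup G g L, conj_subgroup G g M) \<in> U" if "(L, M) \<in> U" "g \<in> carrier G" for L M g
      using that TD(5)[of L M g] subgroups_carrier conj_subgroup_subgroup conj_subgroup_mono
      by (auto simp: U_def subgroup_pairs_def card_conj_subgroup)
  qed
  moreover have "insert (K, H) A \<subseteq> U"
    using A ts_generated_superset[of A] by (auto simp: U_def)
  ultimately have "(L, M) \<in> U" using p(1) ts_generated_least by blast
  then show ?thesis using p(2) by (simp add: U_def)
qed

text \<open>A proper first step with source of order \<open>card K\<close> ends in a larger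
  subgroup, so by the bound above all that follows it lies in \<open>ts_generated G A\<close>. Hence
  a single \<open>f\<close> serves the whole chain.\<close>

lemma ts_generated_exchange:
  assumes fin: "finite (carrier G)"
    and A: "insert (K, H) A \<subseteq> subgroup_pairs G"
    and S': "S' \<subseteq> subgroup_pairs G" "ts_generated G S' = ts_generated G (insert (K, H) A)"
    and new: "(K, H) \<notin> ts_generated G A"
  obtains f where "f \<in> S'" "(K, H) \<in> ts_generated G (insert f A)"
proof -
  let ?T = "ts_generated G (insert (K, H) A)"
  let ?A = "ts_generated G A" and ?Af = "\<lambda>f. ts_generated G (insert f A)"
  define U where "U = {(L, M) \<in> ?T. (L, M) \<in> ?A \<or> card L < card K \<or>
     card L = card K \<and> (\<exists>f\<in>S'. (L, M) \<in> ?Af f)}"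
  have "?T \<in> Tr G" using A by (intro ts_generated_transfer_system) auto
  note TD = transfer_systemD[OF this]
  have "?A \<in> Tr G" using A by (intro ts_generated_transfer_system) auto
  note XD = transfer_systemD[OF this]
  have "?Af f \<in> Tr G" if "f \<in> S'" for f
    using A S' that by (intro ts_generated_transfer_system) auto
  note XfD = transfer_systemD[OF this]
  have XXf: "?A \<subseteq> ?Af f" for f by (intro ts_generated_mono) auto
  have finH: "finite H" if "H \<in> subgroups G" for H
    using that fin subgroups_carrier finite_subset by blast
  have old: "(L, M) \<in> ?A" if "(L, M) \<in> ?T" "card K < card L" for L M
    using card_source_le_of_new_pair[OF fin A that(1)] that(2) by fastforce
  have "U \<in> Tr G"
  proof (rule transfer_systemI)
    show "U \<subseteq> subgroup_pairs G" using TD(1) by (auto simp: U_def)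
    show "(H, H) \<in> U" if "H \<in> subgroups G" for H
      using that TD(2) XD(2) by (auto simp: U_def)
    show "(L, N) \<in> U" if LM: "(L, M) \<in> U" and MN: "(M, N) \<in> U" for L M N
    proof (cases "L = M")
      case True
      then show ?thesis using MN by simp
    next
      case False
      have T: "(L, M) \<in> ?T" "(M, N) \<in> ?T" using LM MN by (auto simp: U_def)
      then have LN: "(L, N) \<in> ?T" by (rule TD(3))
      have "card L < card M"
        using T(1) TD(1) False finH by (auto simp: subgroup_pairs_def intro!: psubset_card_mono)
      consider "card L < card K" | "card L > card K" | "card L = card K" by linarith
      then show ?thesis
      proof cases
        case 1
        then show ?thesis using LN by (simp add: U_def)
      next
        case 2
        then show ?thesis using LN old by (simp add: U_def)
      next
        case 3
        then have MN': "(M, N) \<in> ?A" using T old \<open>card L < card M\<close> by simp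
        consider "(L, M) \<in> ?A" | f where "f \<in> S'" "(L, M) \<in> ?Af f" using LM 3 by (auto simp: U_def)
        then show ?thesis
        proof cases
          case 1
          then show ?thesis using MN' LN XD(3) by (auto simp: U_def)
        next
          case (2 f)
          then have "(L, N) \<in> ?Af f" using MN' XXf XfD(3)[of f L M N] by blast
          then show ?thesis using 2(1) 3 LN by (auto simp: U_def)
        qed
      qed
    qed
    show "(L \<inter> N, N) \<in> U" if LM: "(L, M) \<in> U" and N: "N \<in> subgroups G" "N \<subseteq> M" for L M N
    proof -
      have T: "(L, M) \<in> ?T" using LM by (auto simp: U_def)
      then have LN: "(L \<inter> N, N) \<in> ?T" using N by (rule TD(4))
      \<comment> \<open>If restriction preserves the order of the source, the same \<open>f\<close>
        works; otherwise the order drops below \<open>card K\<close>.\<close>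
      have "card (L \<inter> N) \<le> card L"
        using T TD(1) finH by (auto simp: subgroup_pairs_def intro!: card_mono)
      then have "card (L \<inter> N) < card K" if "card L < card K" using that by simp
      moreover have "card (L \<inter> N) < card K \<or> card (L \<inter> N) = card K" if "card L = card K"
        using that \<open>card (L \<inter> N) \<le> card L\<close> by linarith
      ultimately show ?thesis
        using LM LN N XD(4)[of L M N] XfD(4)[of _ L M N] by (auto simp: U_def)
    qed
    show "(conj_subgroup G g L, conj_subgroup G g M) \<in> U" if LM: "(L, M) \<in> U" and g: "g \<in> carrier G" for L M g
    proof -
      have T: "(L, M) \<in> ?T" using LM by (auto simp: U_def)
      then have "(conj_subgroup G g L, conj_subgroup G g M) \<in> ?T" using g by (rule TD(5))
      moreover have "card (conj_subgroup G g L) = card L"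
        using T TD(1) g subgroups_carrier by (auto simp: subgroup_pairs_def intro!: card_conj_subgroup)
      ultimately show ?thesis
        using LM g XD(5)[of L M g] XfD(5)[of _ L M g] by (auto simp: U_def)
    qed
  qed
  moreover have "S' \<subseteq> U"
  proof
    fix f assume f: "f \<in> S'"
    obtain L M where LM: "f = (L, M)" by (cases f)
    have T: "(L, M) \<in> ?T" using f S'(2) ts_generated_superset[of S'] LM by blast
    have "(L, M) \<in> ?Af f" using ts_generated_superset[of "insert f A"] LM by blast
    moreover have "card L \<le> card K" if "(L, M) \<notin> ?A"
      using card_source_le_of_new_pair[OF fin A T that] .
    ultimately show "f \<in> U" using f T LM by (force simp: U_def)
  qed
  ultimately have "ts_generated G S' \<subseteq> U" by (rule ts_generated_least)
  then have "(K, H) \<in> U" using S'(2) ts_generated_superset[of "insert (K, H) A"] by blast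
  then show thesis using new that by (auto simp: U_def)
qed

lemma finite_subgroup_pairs: "finite (carrier G) \<Longrightarrow> finite (subgroup_pairs G)"
  by (rule finite_subset[of _ "Pow (carrier G) \<times> Pow (carrier G)"])
    (auto simp: subgroup_pairs_def dest: subgroups_carrier)

lemma ts_generated_absorb:
  assumes "insert f A \<subseteq> subgroup_pairs G" "e \<in> ts_generated G (insert f A)"
  shows "ts_generated G (insert e A) \<subseteq> ts_generated G (insert f A)"
  using assms ts_generated_superset[of "insert f A"]
  by (intro ts_generated_least ts_generated_transfer_system) auto

lemma ts_generated_remove_redundant:
  assumes "S \<subseteq> subgroup_pairs G" "x \<in> S" "x \<in> ts_generated G (S - {x})"
  shows "ts_generated G (S - {x}) = ts_generated G S"
proof (rule antisym)
  show "ts_generated G S \<subseteq> ts_generated G (S - {x})"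
    using assms ts_generated_superset[of "S - {x}"]
    by (intro ts_generated_least ts_generated_transfer_system) auto
qed (intro ts_generated_mono, auto)

lemma exists_minimal_generating_subset:
  assumes "finite S" "S \<subseteq> subgroup_pairs G"
  shows "\<exists>S0 \<subseteq> S. minimal_generating_set G (ts_generated G S) S0"
  using assms
proof (induction S rule: finite_psubset_induct)
  case (psubset S)
  show ?case
  proof (cases "\<exists>x\<in>S. x \<in> ts_generated G (S - {x})")
    case True
    then obtain x where x: "x \<in> S" "x \<in> ts_generated G (S - {x})" by blast
    then obtain S0 where "S0 \<subseteq> S - {x}" "minimal_generating_set G (ts_generated G (S - {x})) S0"
      using psubset.IH[of "S - {x}"] psubset.prems by blast
    then show ?thesis
      using ts_generated_remove_redundant[OF psubset.prems x] by auto
  next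
    case False
    then show ?thesis using psubset.prems by (auto simp: minimal_generating_set_def)
  qed
qed

text \<open>Some \<open>e\<close> in \<open>S - S'\<close> is exchanged for an \<open>f\<close> in
  \<open>S'\<close>. A minimal generating subset of the result is no larger than \<open>S\<close>
  and has fewer elements outside \<open>S'\<close>, so induction applies.\<close>

lemma card_minimal_generating_set_le:
  assumes fin: "finite (carrier G)"
    and "minimal_generating_set G T S" "minimal_generating_set G T S'"
  shows "card S' \<le> card S"
  using assms(2)
proof (induction "card (S - S')" arbitrary: S rule: less_induct)
  case less
  have S: "S \<subseteq> subgroup_pairs G" "ts_generated G S = T" "\<And>x. x \<in> S \<Longrightarrow> x \<notin> ts_generated G (S - {x})"
    using less.prems by (auto simp: minimal_generating_set_def)
  have S': "S' \<subseteq> subgroup_pairs G" "ts_generated G S' = T" "\<And>x. x \<in> S' \<Longrightarrow> x \<notin> ts_generated G (S' - {x})"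
    using assms(3) by (auto simp: minimal_generating_set_def)
  have finS: "finite S" using S(1) finite_subgroup_pairs[OF fin] finite_subset by blast
  show ?case
  proof (cases "S \<subseteq> S'")
    case True
    \<comment> \<open>A minimal generating set cannot properly contain another generating set of the
      same system.\<close>
    have "x \<in> S" if "x \<in> S'" for x
    proof (rule ccontr)
      assume "x \<notin> S"
      then have "ts_generated G S \<subseteq> ts_generated G (S' - {x})" using True by (intro ts_generated_mono) auto
      then show False using S'(2,3) that S(2) ts_generated_superset[of S'] by blast
    qed
    then show ?thesis using True finS by (intro card_mono) auto
  next
    case False
    then obtain e where e: "e \<in> S" "e \<notin> S'" by blast
    obtain K H where KH: "e = (K, H)" by (cases e)
    define A where "A = S - {e}"
    have eA: "insert e A = S" using e A_def by blast
    obtain f where f: "f \<in> S'" "e \<in> ts_generated G (insert f A)"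
      using ts_generated_exchange[OF fin, of K H A S'] S S' eA e KH A_def by metis
    have fA: "insert f A \<subseteq> subgroup_pairs G" using f(1) S'(1) S(1) A_def by blast
    have "ts_generated G (insert f A) = T"
    proof (rule antisym)
      show "T \<subseteq> ts_generated G (insert f A)"
        using ts_generated_absorb[OF fA f(2)] S(2) eA by simp
      have "f \<in> T" using f(1) S'(2) ts_generated_superset[of S'] by blast
      then show "ts_generated G (insert f A) \<subseteq> T"
        using ts_generated_absorb[of e A f] S(1,2) eA by simp
    qed
    then obtain S1 where S1: "S1 \<subseteq> insert f A" "minimal_generating_set G T S1"
      using exists_minimal_generating_subset[of "insert f A"] fA finS A_def by auto
    have "S1 - S' \<subseteq> S - S' - {e}" using S1(1) f(1) A_def by blast
    then have "S1 - S' \<subset> S - S'" using e by blast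
    then have "card (S1 - S') < card (S - S')" using finS by (simp add: psubset_card_mono)
    then have "card S' \<le> card S1" using less.hyps S1(2) by blast
    also have "\<dots> \<le> card (insert f A)" using S1(1) finS A_def by (intro card_mono) auto
    also have "\<dots> \<le> Suc (card A)" by (simp add: card_insert_le_m1 card_insert_if A_def finS)
    also have "\<dots> = card S" using finS e A_def by (metis card_Suc_Diff1)
    finally show ?thesis .
  qed
qed

lemma min_gen_size_eq:
  assumes "finite (carrier G)" "minimal_generating_set G T S"
  shows "min_gen_size G T = card S"
  unfolding min_gen_size_def
  using assms card_minimal_generating_set_le by (intro the_equality) (blast, meson order_antisym)

lemma card_le_complexity:
  assumes fin: "finite (carrier G)" and S: "minimal_generating_set G T S"
  shows "card S \<le> complexity G"
proof -
  have "T \<in> Tr G"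
    using S ts_generated_transfer_system by (auto simp: minimal_generating_set_def)
  have "Tr G \<subseteq> Pow (subgroup_pairs G)" using transfer_systemD(1) by blast
  then have "finite (Tr G)" using finite_subgroup_pairs[OF fin] finite_subset by blast
  moreover have "min_gen_size G T \<in> {min_gen_size G T | T. T \<in> Tr G}" using \<open>T \<in> Tr G\<close> by blast
  ultimately show ?thesis
    using min_gen_size_eq[OF fin S] unfolding complexity_def by simp
qed

section \<open>Transfer systems from invariant families, and independence\<close>

text \<open>Quantifying over all subgroups \<open>N\<close> of the target makes the condition stable
  under restriction. For a composite through \<open>K\<close> it is applied first to
  \<open>N \<inter> K\<close> and then to \<open>N\<close>.\<close>

lemma family_transfer_system:
  assumes conj: "\<And>N g. N \<in> subgroups G \<Longrightarrow> g \<in> carrier G \<Longrightarrow> P N \<Longrightarrow> P (conj_subgroup G g N)"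
  shows "{(L, M) \<in> subgroup_pairs G. \<forall>N \<in> subgroups G. N \<subseteq> M \<longrightarrow> P (N \<inter> L) \<longrightarrow> P N} \<in> Tr G"
    (is "?U \<in> _")
proof (rule transfer_systemI)
  show "?U \<subseteq> subgroup_pairs G" by auto
  show "(H, H) \<in> ?U" if "H \<in> subgroups G" for H
    using that by (auto simp: subgroup_pairs_def Int_absorb2)
  show "(L, H) \<in> ?U" if "(L, K) \<in> ?U" "(K, H) \<in> ?U" for L K H
  proof -
    have "P N" if N: "N \<in> subgroups G" "N \<subseteq> H" "P (N \<inter> L)" for N
    proof -
      have "N \<inter> K \<inter> L = N \<inter> L" using \<open>(L, K) \<in> ?U\<close> by (auto simp: subgroup_pairs_def)
      then have "P (N \<inter> K)"
        using \<open>(L, K) \<in> ?U\<close> N subgroups_Int[of N K] by (auto simp: subgroup_pairs_def)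
      then show ?thesis using \<open>(K, H) \<in> ?U\<close> N by blast
    qed
    then show ?thesis using that by (auto simp: subgroup_pairs_def)
  qed
  show "(K \<inter> L, L) \<in> ?U" if KH: "(K, H) \<in> ?U" and L: "L \<in> subgroups G" "L \<subseteq> H" for K H L
  proof -
    have "P N" if N: "N \<in> subgroups G" "N \<subseteq> L" "P (N \<inter> (K \<inter> L))" for N
    proof -
      have "N \<inter> (K \<inter> L) = N \<inter> K" using N(2) by blast
      then show ?thesis using KH N L by auto
    qed
    then show ?thesis using KH L subgroups_Int by (auto simp: subgroup_pairs_def)
  qed
  show "(conj_subgroup G g K, conj_subgroup G g H) \<in> ?U"
    if KH: "(K, H) \<in> ?U" and g: "g \<in> carrier G" for K H g
  proof -
    have sub: "K \<in> subgroups G" "H \<in> subgroups G" "K \<subseteq> H"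
      using KH by (auto simp: subgroup_pairs_def)
    have "P N" if N: "N \<in> subgroups G" "N \<subseteq> conj_subgroup G g H" "P (N \<inter> conj_subgroup G g K)" for N
    proof -
      \<comment> \<open>Conjugating \<open>N\<close> back allows the condition for
        \<open>(K, H)\<close> to be applied; invariance carries \<open>P\<close> in both
        directions.\<close>
      let ?N = "conj_subgroup G (inv g) N"
      have c: "N \<subseteq> carrier G" "K \<subseteq> carrier G" "H \<subseteq> carrier G" "inv g \<in> carrier G"
        using N(1) sub g subgroups_carrier by auto
      have "?N \<subseteq> H"
        using conj_subgroup_mono[OF N(2), of "inv g"] conj_subgroup_inv(1)[OF c(3) g] by simp
      moreover have "?N \<inter> K = conj_subgroup G (inv g) (N \<inter> conj_subgroup G g K)"
        using c g sub conj_subgroup_subgroup[THEN subgroups_carrier]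
        by (simp add: conj_subgroup_Int conj_subgroup_inv)
      then have "P (?N \<inter> K)"
        using N g sub c conj_subgroup_subgroup subgroups_Int by (auto intro!: conj)
      ultimately have "P ?N" using KH c N(1) conj_subgroup_subgroup by blast
      then have "P (conj_subgroup G g ?N)" using c N(1) g conj_subgroup_subgroup conj[of ?N g] by blast
      then show ?thesis using conj_subgroup_inv(2)[OF c(1) g] by simp
    qed
    then show ?thesis
      using sub g conj_subgroup_subgroup conj_subgroup_mono by (auto simp: subgroup_pairs_def)
  qed
qed

text \<open>Labelling the pairs by \<open>I\<close> lets the size be counted on labels: a system
  that misses \<open>p x\<close> but contains every other \<open>p y\<close> also forces
  \<open>p\<close> to be injective.\<close>

lemma card_le_complexity_of_separated:
  assumes fin: "finite (carrier G)"
    and pairs: "\<And>x. x \<in> I \<Longrightarrow> p x \<in> subgroup_pairs G"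
    and sep: "\<And>x. x \<in> I \<Longrightarrow> \<exists>T \<in> Tr G. p x \<notin> T \<and> (\<forall>y \<in> I - {x}. p y \<in> T)"
  shows "card I \<le> complexity G"
proof -
  have inj: "inj_on p I"
    by (rule inj_onI) (metis sep DiffI singletonD)
  have "minimal_generating_set G (ts_generated G (p ` I)) (p ` I)"
    unfolding minimal_generating_set_def
  proof (intro conjI ballI)
    show "p ` I \<subseteq> subgroup_pairs G" using pairs by blast
    fix e assume "e \<in> p ` I"
    then obtain x where x: "x \<in> I" "e = p x" by blast
    obtain T where T: "T \<in> Tr G" "p x \<notin> T" "\<forall>y \<in> I - {x}. p y \<in> T" using sep[OF x(1)] by blast
    have "ts_generated G (p ` I - {e}) \<subseteq> T"
      using T x by (intro ts_generated_least) auto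
    then show "e \<notin> ts_generated G (p ` I - {e})" using T(2) x(2) by blast
  qed simp
  from card_le_complexity[OF fin this] show ?thesis using inj by (simp add: card_image)
qed

end

section \<open>Semidihedral groups\<close>

text \<open>To be applied to \<open>C i\<close> and \<open>rfls c\<close>. Inclusion for both
  \<open>g\<close> and \<open>inv g\<close> gives \<open>conj_subgroup G g Z = Z\<close>.\<close>

lemma (in group) invariant_conj_subgroup_iff:
  assumes Z: "Z \<subseteq> carrier G" "\<And>g. g \<in> carrier G \<Longrightarrow> conj_subgroup G g Z \<subseteq> Z"
    and N: "N \<subseteq> carrier G" and g: "g \<in> carrier G"
  shows "Z \<subseteq> conj_subgroup G g N \<longleftrightarrow> Z \<subseteq> N"
    and "conj_subgroup G g N \<inter> Z = {} \<longleftrightarrow> N \<inter> Z = {}"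
proof -
  have Z_eq: "conj_subgroup G g Z = Z"
    using conj_subgroup_mono[OF Z(2)[of "inv g"], of g] conj_subgroup_inv(2)[OF Z(1) g] Z(2)[OF g] g
    by auto
  have "Z \<subseteq> N" if "conj_subgroup G g Z \<subseteq> conj_subgroup G g N"
    using conj_subgroup_mono[OF that, of "inv g"] conj_subgroup_inv(1) Z(1) N g by simp
  then show "Z \<subseteq> conj_subgroup G g N \<longleftrightarrow> Z \<subseteq> N"
    using conj_subgroup_mono[of Z N g] Z_eq by auto
  have "conj_subgroup G g N \<inter> Z = conj_subgroup G g (N \<inter> Z)"
    using conj_subgroup_Int[OF N Z(1) g] Z_eq by simp
  then show "conj_subgroup G g N \<inter> Z = {} \<longleftrightarrow> N \<inter> Z = {}"
    by (simp add: conj_subgroup_image)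
qed

text \<open>The factor \<open>2 ^ (n - 2) - 2\<close> is even and supplies the missing power of 2.
  Thus multiplication by \<open>2 ^ (n - 2) - 1\<close> is an involution modulo
  \<open>2 ^ (n - 1)\<close>.\<close>

lemma semidihedral_unit_square:
  assumes "n \<ge> 4"
  shows "(2::int) ^ (n - 1) dvd (2 ^ (n - 2) - 1) * (2 ^ (n - 2) - 1) - 1"
proof -
  have "(2 ^ (n - 2) - 1) * (2 ^ (n - 2) - 1) - 1 = (2::int) ^ (n - 2) * (2 ^ (n - 2) - 2)"
    by (simp add: algebra_simps)
  moreover have "n - 1 = Suc (n - 2)" using assms by simp
  then have "(2::int) ^ (n - 1) = 2 ^ (n - 2) * 2" by simp
  moreover have "(2::int) dvd 2 ^ (n - 2) - 2" using assms by simp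
  ultimately show ?thesis by (simp only: mult_dvd_mono dvd_refl)
qed

datatype edge = CC nat | CD nat | CQ nat | DD nat | QQ nat

text \<open>This separates the subgroup computations from words: it fixes the order of
  \<open>a\<close>, the relations and the normal forms. Integer exponents avoid truncated
  subtraction.\<close>

locale semidihedral = group G for G (structure) +
  fixes a b :: 'a and n :: nat
  assumes n: "n \<ge> 4"
    and a [simp]: "a \<in> carrier G" and b [simp]: "b \<in> carrier G"
    and a_pow_eq_one_iff: "\<And>x::int. a [^] x = \<one> \<longleftrightarrow> 2 ^ (n - 1) dvd x"
    and b_b: "b \<otimes> b = \<one>"
    and b_a_b: "b \<otimes> a \<otimes> b = a [^] (2 ^ (n - 2) - 1 :: int)"
    and b_neq_a_pow: "\<And>x::int. b \<noteq> a [^] x"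
    and carrier_cases: "\<And>g. g \<in> carrier G \<Longrightarrow> \<exists>x::int. g = a [^] x \<or> g = a [^] x \<otimes> b"
begin

section \<open>Normal forms and multiplication rules\<close>

definition rot :: "int \<Rightarrow> 'a" where "rot x = a [^] x"

definition rfl :: "int \<Rightarrow> 'a" where "rfl x = a [^] x \<otimes> b"

definition r :: int where "r = 2 ^ (n - 2) - 1"

lemma rot_closed [simp]: "rot x \<in> carrier G" by (simp add: rot_def)

lemma rfl_closed [simp]: "rfl x \<in> carrier G" by (simp add: rfl_def)

lemma carrier_eq: "g \<in> carrier G \<longleftrightarrow> (\<exists>x. g = rot x) \<or> (\<exists>x. g = rfl x)"
  using carrier_cases[of g] rot_closed rfl_closed by (auto simp: rot_def rfl_def)

lemma r_square: "2 ^ (n - 1) dvd r * r - 1"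
  unfolding r_def by (rule semidihedral_unit_square[OF n])

lemma odd_r: "odd r"
  using n by (simp add: r_def)

lemma rot_eq_iff: "rot x = rot y \<longleftrightarrow> 2 ^ (n - 1) dvd x - y"
proof -
  have "a [^] (x - y) = a [^] x \<otimes> inv (a [^] y)" by (simp add: int_pow_diff)
  then have "a [^] (x - y) = \<one> \<longleftrightarrow> a [^] x = a [^] y"
    by (metis a int_pow_closed inv_closed inv_equality inv_inv r_inv)
  then show ?thesis using a_pow_eq_one_iff[of "x - y"] by (simp add: rot_def)
qed

lemma rfl_eq_iff: "rfl x = rfl y \<longleftrightarrow> 2 ^ (n - 1) dvd x - y"
  using rot_eq_iff[of x y] by (simp add: rot_def rfl_def)

lemma rot_neq_rfl [simp]: "rot x \<noteq> rfl y" "rfl y \<noteq> rot x"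
proof -
  have "b = rot (x - y)" if "rot x = rfl y"
  proof -
    have "rot y \<otimes> rot (x - y) = rot y \<otimes> b"
      using that by (simp add: rot_def rfl_def flip: int_pow_mult)
    then show ?thesis by simp
  qed
  then show "rot x \<noteq> rfl y" using b_neq_a_pow by (auto simp: rot_def)
  then show "rfl y \<noteq> rot x" by metis
qed

lemma rot_rot: "rot x \<otimes> rot y = rot (x + y)"
  by (simp add: rot_def int_pow_mult)

lemma rot_rfl: "rot x \<otimes> rfl y = rfl (x + y)"
  by (simp add: rot_def rfl_def int_pow_mult m_assoc)

lemma b_rot: "b \<otimes> rot x = rfl (r * x)"
proof -
  have nat: "b \<otimes> rot (int k) = rfl (r * int k)" for k
  proof (induction k)
    case 0
    then show ?case by (simp add: rot_def rfl_def)
  next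
    case (Suc k)
    have ba: "b \<otimes> a = rfl r"
    proof -
      have "b \<otimes> a = b \<otimes> a \<otimes> b \<otimes> b" using b_b by (simp add: m_assoc)
      then show ?thesis unfolding rfl_def r_def b_a_b by simp
    qed
    have "rot (int (Suc k)) = rot (int k) \<otimes> a"
      using rot_rot[of "int k" 1] by (simp add: rot_def add.commute)
    then have "b \<otimes> rot (int (Suc k)) = rfl (r * int k) \<otimes> a"
      using Suc by (simp flip: m_assoc)
    also have "\<dots> = rot (r * int k) \<otimes> (b \<otimes> a)" by (simp add: rfl_def rot_def m_assoc)
    also have "\<dots> = rfl (r * int k + r)" unfolding ba rot_rfl by simp
    finally show ?case by (simp add: algebra_simps)
  qed
  \<comment> \<open>An integer exponent is replaced by its residue modulo the order of
    \<open>a\<close>, to which the induction applies.\<close>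
  define k where "k = nat (x mod 2 ^ (n - 1))"
  have d: "2 ^ (n - 1) dvd x - int k" by (simp add: k_def minus_mod_eq_mult_div)
  then have "rot x = rot (int k)" by (simp add: rot_eq_iff)
  moreover have "rfl (r * x) = rfl (r * int k)"
    unfolding rfl_eq_iff right_diff_distrib[symmetric] using d by simp
  ultimately show ?thesis using nat by simp
qed

lemma rfl_rot: "rfl x \<otimes> rot y = rfl (x + r * y)"
proof -
  have "rfl x \<otimes> rot y = rot x \<otimes> (b \<otimes> rot y)" by (simp add: rfl_def rot_def m_assoc)
  then show ?thesis by (simp add: b_rot rot_rfl)
qed

lemma rfl_rfl: "rfl x \<otimes> rfl y = rot (x + r * y)"
proof -
  have "rfl x \<otimes> rfl y = rfl x \<otimes> rot y \<otimes> b" by (simp add: rfl_def rot_def m_assoc)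
  also have "\<dots> = rot (x + r * y) \<otimes> (b \<otimes> b)"
    unfolding rfl_rot by (simp add: rfl_def rot_def m_assoc)
  finally show ?thesis by (simp add: b_b)
qed

lemma inv_rot: "inv (rot x) = rot (- x)"
  by (simp add: rot_def int_pow_neg)

lemma inv_rfl: "inv (rfl x) = rfl (- r * x)"
proof (rule inv_equality)
  have "2 ^ (n - 1) dvd (r * r - 1) * (- x)" using r_square by (rule dvd_mult2)
  have "rfl x \<otimes> rfl (- r * x) = \<one>"
  proof -
    have "rot (x + r * (- r * x)) = rot 0"
      unfolding rot_eq_iff using \<open>2 ^ (n - 1) dvd (r * r - 1) * (- x)\<close> by (simp add: algebra_simps)
    then show ?thesis unfolding rfl_rfl by (simp add: rot_def)
  qed
  then show "rfl (- r * x) \<otimes> rfl x = \<one>" using inv_comm rfl_closed by blast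
qed auto

lemma finite_carrier: "finite (carrier G)"
proof -
  define D where "D = {0..<(2::int) ^ (n - 1)}"
  have "g \<in> rot ` D \<union> rfl ` D" if "g \<in> carrier G" for g
  proof -
    have D: "x mod 2 ^ (n - 1) \<in> D" for x by (simp add: D_def)
    have "rot x = rot (x mod 2 ^ (n - 1))" "rfl x = rfl (x mod 2 ^ (n - 1))" for x
      by (simp_all add: rot_eq_iff rfl_eq_iff minus_mod_eq_mult_div)
    then show ?thesis using that D unfolding carrier_eq by blast
  qed
  then have "carrier G \<subseteq> rot ` D \<union> rfl ` D" by blast
  then show ?thesis by (rule finite_subset) (simp add: D_def)
qed

section \<open>Cyclic, dihedral and quaternion subgroups, and the two kinds of reflections\<close>

text \<open>\<open>C i\<close> is the rotation subgroup of order \<open>2 ^ i\<close>, and \<open>E l c\<close> is the subgroup of order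
  \<open>2 ^ (l + 1)\<close> with rotation subgroup \<open>C l\<close>; it is dihedral for even and quaternion for odd \<open>c\<close>,
  unless it is the whole group.\<close>

definition C :: "nat \<Rightarrow> 'a set" where
  "C i = {rot x | x. 2 ^ (n - 1 - i) dvd x}"

definition E :: "nat \<Rightarrow> int \<Rightarrow> 'a set" where
  "E l c = C l \<union> {rfl x | x. 2 ^ (n - 1 - l) dvd x - c}"

text \<open>The square of \<open>rfl x\<close> is \<open>rot (2 ^ (n - 2) * x)\<close>, so even
  \<open>c\<close> gives the involutions outside the rotations and odd \<open>c\<close> the elements
  of order 4 there.\<close>

definition rfls :: "int \<Rightarrow> 'a set" where
  "rfls c = {rfl x | x. even (x - c)}"

definition has_rfl :: "int \<Rightarrow> 'a set \<Rightarrow> bool" where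
  "has_rfl c N \<longleftrightarrow> N \<inter> rfls c \<noteq> {}"

text \<open>Exponents are determined only modulo \<open>2 ^ (n - 1)\<close>; this makes the
  congruences in \<open>C\<close> and \<open>E\<close> independent of the representative.\<close>

lemma pow_dvd_of_cong:
  assumes "2 ^ (n - 1) dvd x - y" "2 ^ (n - 1 - i) dvd y - c"
  shows "2 ^ (n - 1 - i) dvd x - (c::int)"
proof -
  have "(2::int) ^ (n - 1 - i) dvd 2 ^ (n - 1)" by (intro le_imp_power_dvd) simp
  then have "2 ^ (n - 1 - i) dvd (x - y) + (y - c)" using assms by (meson dvd_add dvd_trans)
  then show ?thesis by simp
qed

lemma rot_in_C: "rot x \<in> C i \<longleftrightarrow> 2 ^ (n - 1 - i) dvd x"
  using pow_dvd_of_cong[of x _ i 0] by (auto simp: C_def rot_eq_iff intro!: exI[of _ x])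

lemma rfl_in_C [simp]: "rfl x \<notin> C i"
  by (auto simp: C_def)

lemma rot_in_E: "rot x \<in> E l c \<longleftrightarrow> 2 ^ (n - 1 - l) dvd x"
  by (auto simp: E_def rot_in_C)

lemma rfl_in_E: "rfl x \<in> E l c \<longleftrightarrow> 2 ^ (n - 1 - l) dvd x - c"
  using pow_dvd_of_cong[of x _ l c] by (auto simp: E_def rfl_eq_iff intro!: exI[of _ x])

lemma rot_in_rfls [simp]: "rot x \<notin> rfls c"
  by (auto simp: rfls_def)

lemma even_diff_of_cong: "2 ^ (n - 1) dvd x - y \<Longrightarrow> even (x - (y::int))"
  using n dvd_trans[of 2 "2 ^ (n - 1)" "x - y"] by simp

lemma rfl_in_rfls: "rfl x \<in> rfls c \<longleftrightarrow> even (x - c)"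
proof -
  have "even (x - c)" if "rfl x = rfl y" "even (y - c)" for y
  proof -
    have "even (x - y)" using that(1) even_diff_of_cong unfolding rfl_eq_iff by blast
    then show ?thesis using that(2) by presburger
  qed
  then show ?thesis unfolding rfls_def by blast
qed

lemma C_carrier: "C i \<subseteq> carrier G" and E_carrier: "E l c \<subseteq> carrier G"
  and rfls_carrier: "rfls c \<subseteq> carrier G"
  by (auto simp: C_def E_def rfls_def)

lemma C_subgroup: "C i \<in> subgroups G"
proof -
  have "\<one> = rot 0" by (simp add: rot_def)
  then have "subgroup (C i) G"
    using C_carrier by (intro subgroupI) (auto simp: C_def inv_rot rot_rot)
  then show ?thesis by (simp add: subgroups_def)
qed

text \<open>Products of reflections require \<open>2 ^ (n - 1 - l)\<close> to divide
  \<open>(r + 1) * c\<close>, which is \<open>2 ^ (n - 2) * c\<close>. For \<open>c = 1\<close> this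
  is where \<open>1 \<le> l\<close> enters: \<open>rfl 1\<close> has order 4.\<close>

lemma E_subgroup:
  assumes "c = 0 \<or> c = 1 \<and> 1 \<le> l"
  shows "E l c \<in> subgroups G"
proof -
  let ?k = "n - 1 - l"
  have rc: "2 ^ ?k dvd r * c + c"
  proof -
    have "(2::int) ^ ?k dvd 2 ^ (n - 2)" if "1 \<le> l" using that by (intro le_imp_power_dvd) simp
    then show ?thesis using assms by (auto simp: r_def)
  qed
  have rfl_mult: "2 ^ ?k dvd x + r * y" if "2 ^ ?k dvd x - c" "2 ^ ?k dvd y - c" for x y
  proof -
    have "2 ^ ?k dvd (x - c) + r * (y - c) + (r * c + c)" by (intro dvd_add dvd_mult that rc)
    then show ?thesis by (simp add: algebra_simps)
  qed
  have rfl_inv: "2 ^ ?k dvd - r * x - c" if "2 ^ ?k dvd x - c" for x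
  proof -
    have "2 ^ ?k dvd - (r * (x - c)) - (r * c + c)"
      using that rc by (meson dvd_diff dvd_minus_iff dvd_mult)
    also have "- (r * (x - c)) - (r * c + c) = - r * x - c" by (simp add: algebra_simps)
    finally show ?thesis .
  qed
  have add1: "2 ^ ?k dvd x + y - c" if "2 ^ ?k dvd x" "2 ^ ?k dvd y - c" for x y
    using dvd_add[OF that] by (simp add: algebra_simps)
  have add2: "2 ^ ?k dvd x + r * y - c" if "2 ^ ?k dvd x - c" "2 ^ ?k dvd y" for x y
    using dvd_add[OF that(1) dvd_mult[OF that(2)], of r] by (simp add: algebra_simps)
  have "subgroup (E l c) G"
  proof (rule subgroupI)
    show "E l c \<subseteq> carrier G" by (rule E_carrier)
    have "rot 0 \<in> E l c" by (simp add: rot_in_E)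
    then show "E l c \<noteq> {}" by blast
    show "inv g \<in> E l c" if "g \<in> E l c" for g
    proof -
      have "g \<in> carrier G" using that E_carrier by blast
      then show ?thesis
        unfolding carrier_eq using that rfl_inv
        by (auto simp: inv_rot inv_rfl rot_in_E rfl_in_E simp del: mult_minus_left)
    qed
    show "g \<otimes> g' \<in> E l c" if "g \<in> E l c" "g' \<in> E l c" for g g'
    proof -
      have "g \<in> carrier G" "g' \<in> carrier G" using that E_carrier by blast+
      then show ?thesis
        unfolding carrier_eq using that rfl_mult add1 add2
        by (auto simp: rot_rot rot_rfl rfl_rot rfl_rfl rot_in_E rfl_in_E)
    qed
  qed
  then show ?thesis by (simp add: subgroups_def)
qed

lemma C_invariant: "g \<in> carrier G \<Longrightarrow> conj_subgroup G g (C i) \<subseteq> C i"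
proof -
  assume "g \<in> carrier G"
  then consider x where "g = rot x" | x where "g = rfl x" unfolding carrier_eq by blast
  then show ?thesis
  proof cases
    case (1 x)
    then show ?thesis by (auto simp: conj_subgroup_image C_def inv_rot rot_rot)
  next
    case (2 x)
    \<comment> \<open>The shift \<open>x\<close> cancels because \<open>r * r\<close> is 1 modulo
      the order of \<open>a\<close>.\<close>
    have "rfl x \<otimes> rot y \<otimes> inv (rfl x) = rot (r * y)" for y
    proof -
      have "2 ^ (n - 1) dvd (r * r - 1) * (- x)" using r_square by (rule dvd_mult2)
      then have "rot (x + r * y + r * (- r * x)) = rot (r * y)"
        unfolding rot_eq_iff by (simp add: algebra_simps)
      then show ?thesis by (simp add: inv_rfl rfl_rot rfl_rfl del: mult_minus_left)
    qed
    then show ?thesis using 2 by (auto simp: conj_subgroup_image C_def)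
  qed
qed

text \<open>Since \<open>r\<close> is odd, conjugation changes the exponent of a reflection by an
  even number.\<close>

lemma rfls_invariant: "g \<in> carrier G \<Longrightarrow> conj_subgroup G g (rfls c) \<subseteq> rfls c"
proof -
  assume "g \<in> carrier G"
  then consider x where "g = rot x" | x where "g = rfl x" unfolding carrier_eq by blast
  then show ?thesis
  proof cases
    case (1 x)
    have "rot x \<otimes> rfl y \<otimes> inv (rot x) \<in> rfls c" if "even (y - c)" for y
      unfolding inv_rot rot_rfl rfl_rot rfl_in_rfls using that odd_r by auto
    then show ?thesis unfolding conj_subgroup_image rfls_def 1 by blast
  next
    case (2 x)
    have "rfl x \<otimes> rfl y \<otimes> inv (rfl x) \<in> rfls c" if "even (y - c)" for y
      unfolding inv_rfl rfl_rfl rot_rfl rfl_in_rfls using that odd_r by auto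
    then show ?thesis unfolding conj_subgroup_image rfls_def 2 by blast
  qed
qed

lemma C_subset_C: "i \<le> n - 1 \<Longrightarrow> j \<le> n - 1 \<Longrightarrow> C i \<subseteq> C j \<longleftrightarrow> i \<le> j"
proof -
  assume ij: "i \<le> n - 1" "j \<le> n - 1"
  have "i \<le> j" if "C i \<subseteq> C j"
  proof -
    have "rot (2 ^ (n - 1 - i)) \<in> C j" using that rot_in_C[of "2 ^ (n - 1 - i)" i] by auto
    then have "(2::int) ^ (n - 1 - j) dvd 2 ^ (n - 1 - i)" by (simp add: rot_in_C)
    then have "n - 1 - j \<le> n - 1 - i" by (simp add: dvd_power_iff)
    then show ?thesis using ij by linarith
  qed
  moreover have "C i \<subseteq> C j" if "i \<le> j"
  proof -
    have "(2::int) ^ (n - 1 - j) dvd 2 ^ (n - 1 - i)" using that by (intro le_imp_power_dvd) simp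
    then show ?thesis by (auto simp: C_def intro: dvd_trans)
  qed
  ultimately show ?thesis by blast
qed

lemma C_subset_E: "i \<le> n - 1 \<Longrightarrow> l \<le> n - 1 \<Longrightarrow> C i \<subseteq> E l c \<longleftrightarrow> i \<le> l"
proof -
  assume "i \<le> n - 1" "l \<le> n - 1"
  moreover have "C i \<subseteq> E l c \<longleftrightarrow> C i \<subseteq> C l" by (auto simp: C_def E_def)
  ultimately show ?thesis by (simp add: C_subset_C)
qed

lemma E_mono: "l \<le> l' \<Longrightarrow> E l c \<subseteq> E l' c"
proof -
  assume "l \<le> l'"
  then have "(2::int) ^ (n - 1 - l') dvd 2 ^ (n - 1 - l)" by (intro le_imp_power_dvd) simp
  then show ?thesis by (auto simp: E_def C_def intro: dvd_trans)
qed

lemma has_rfl_C [simp]: "\<not> has_rfl c (C i)"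
  by (auto simp: has_rfl_def C_def)

text \<open>For \<open>l < n - 1\<close> the modulus in \<open>E l c\<close> is even and fixes the
  parity of its reflections. From \<open>n - 1\<close> on, the truncated exponent is 0 and
  \<open>E l c\<close> is the whole group.\<close>

lemma has_rfl_E: "has_rfl c' (E l c) \<longleftrightarrow> even (c - c') \<or> n - 1 \<le> l"
proof -
  have "even (c - c')" if x: "rfl x \<in> E l c" "rfl x \<in> rfls c'" and l: "l < n - 1" for x
  proof -
    have "(2::int) dvd 2 ^ (n - 1 - l)" using l by simp
    then have "even (x - c)" using x(1) dvd_trans unfolding rfl_in_E by blast
    moreover have "even (x - c')" using x(2) by (simp add: rfl_in_rfls)
    ultimately show ?thesis by simp
  qed
  moreover have "rfl c \<in> E l c \<inter> rfls c'" if "even (c - c')"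
    using that by (simp add: rfl_in_E rfl_in_rfls)
  moreover have "rfl c' \<in> E l c \<inter> rfls c'" if "n - 1 \<le> l"
    using that by (simp add: rfl_in_E rfl_in_rfls)
  moreover have "\<exists>x. y = rfl x" if "y \<in> rfls c'" for y using that by (auto simp: rfls_def)
  ultimately show ?thesis unfolding has_rfl_def by (metis IntD1 IntD2 disjoint_iff not_le_imp_less empty_iff)
qed

section \<open>The independent set of transfers\<close>

definition separated :: "('a set \<Rightarrow> bool) \<Rightarrow> 'a set \<times> 'a set \<Rightarrow> bool" where
  "separated P e \<longleftrightarrow> (\<forall>N \<in> subgroups G. N \<subseteq> snd e \<longrightarrow> P (N \<inter> fst e) \<longrightarrow> P N)"

lemma separating_transfer_system:
  assumes conj: "\<And>N g. N \<in> subgroups G \<Longrightarrow> g \<in> carrier G \<Longrightarrow> P (conj_subgroup G g N) = P N"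
    and "e \<in> subgroup_pairs G" "P (fst e)" "\<not> P (snd e)"
  shows "\<exists>T \<in> Tr G. e \<notin> T \<and> (\<forall>f \<in> subgroup_pairs G. separated P f \<longrightarrow> f \<in> T)"
proof (rule bexI)
  let ?T = "{(L, M) \<in> subgroup_pairs G. \<forall>N \<in> subgroups G. N \<subseteq> M \<longrightarrow> P (N \<inter> L) \<longrightarrow> P N}"
  show "?T \<in> Tr G" by (rule family_transfer_system) (simp add: conj)
  \<comment> \<open>The target of \<open>e\<close>, taken as \<open>N\<close>, violates the
    condition for \<open>e\<close>.\<close>
  have "snd e \<inter> fst e = fst e" using assms(2) by (auto simp: subgroup_pairs_def)
  then have "e \<notin> ?T" using assms(2,3,4) by (auto simp: subgroup_pairs_def)
  then show "e \<notin> ?T \<and> (\<forall>f \<in> subgroup_pairs G. separated P f \<longrightarrow> f \<in> ?T)"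
    by (auto simp: separated_def)
qed

text \<open>Each constructor names the types of source and target: cyclic, dihedral or quaternion.
  Since \<open>\<bar>E l c\<bar> = 2 ^ (l + 1)\<close>, the three targets of \<open>C i\<close> all have order \<open>2 ^ (2 * h + 1 - i)\<close>.
  For odd \<open>n\<close> this is the order of the whole group when \<open>i = 0\<close>, so that the three targets would
  coincide; \<open>edges 1 h\<close> then keeps only one of them.\<close>

definition edge_pair :: "nat \<Rightarrow> edge \<Rightarrow> 'a set \<times> 'a set" where
  "edge_pair h e = (case e of
     CC i \<Rightarrow> (C i, C (2 * h + 1 - i))
   | CD i \<Rightarrow> (C i, E (2 * h - i) 0)
   | CQ i \<Rightarrow> (C i, E (2 * h - i) 1)
   | DD l \<Rightarrow> (E l 0, E (l + 1) 0)
   | QQ l \<Rightarrow> (E l 1, E (l + 1) 1))"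

definition edges :: "nat \<Rightarrow> nat \<Rightarrow> edge set" where
  "edges d h = CC ` {d..h} \<union> CD ` {..h} \<union> CQ ` {d..h} \<union> DD ` {..<h} \<union> QQ ` {1..<h}"

text \<open>\<open>edge_family h e\<close> holds for the source of \<open>e\<close> and fails for its target, and no transfer
  generated by the other edges leads out of it.\<close>

definition edge_family :: "nat \<Rightarrow> edge \<Rightarrow> 'a set \<Rightarrow> bool" where
  "edge_family h e N \<longleftrightarrow> (case e of
     CC i \<Rightarrow> C i \<subseteq> N \<and> \<not> C (2 * h + 1 - i) \<subseteq> N
   | CD i \<Rightarrow> C i \<subseteq> N \<and> \<not> (C (2 * h - i) \<subseteq> N \<and> has_rfl 0 N)
   | CQ i \<Rightarrow> C i \<subseteq> N \<and> \<not> (C (2 * h - i) \<subseteq> N \<and> has_rfl 1 N)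
   | DD l \<Rightarrow> has_rfl 0 N \<and> \<not> C (l + 1) \<subseteq> N
   | QQ l \<Rightarrow> has_rfl 1 N \<and> \<not> C (l + 1) \<subseteq> N)"

lemma edge_family_conj:
  assumes "N \<in> subgroups G" "g \<in> carrier G"
  shows "edge_family h e (conj_subgroup G g N) = edge_family h e N"
proof -
  have N: "N \<subseteq> carrier G" using assms(1) by (rule subgroups_carrier)
  have "has_rfl c (conj_subgroup G g N) = has_rfl c N" for c
    by (simp add: has_rfl_def invariant_conj_subgroup_iff(2)[OF rfls_carrier rfls_invariant N assms(2)])
  then show ?thesis
    by (cases e) (simp_all add: edge_family_def invariant_conj_subgroup_iff(1)[OF C_carrier C_invariant N assms(2)])
qed

text \<open>Here \<open>d\<close> is 1 for odd \<open>n\<close> and 0 for even \<open>n\<close>, and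
  \<open>h\<close> is \<open>(n - 1) div 2\<close>; all rotations together form
  \<open>C (2 * h + 1 - d)\<close>.\<close>

context
  fixes d h :: nat
  assumes dh: "n + d = 2 * h + 2" "d \<le> 1"
begin

lemma h_pos: "1 \<le> h" using dh n by simp

lemma in_edges [simp]:
  "CC i \<in> edges d h \<longleftrightarrow> d \<le> i \<and> i \<le> h" "CD i \<in> edges d h \<longleftrightarrow> i \<le> h"
  "CQ i \<in> edges d h \<longleftrightarrow> d \<le> i \<and> i \<le> h" "DD l \<in> edges d h \<longleftrightarrow> l < h"
  "QQ l \<in> edges d h \<longleftrightarrow> 1 \<le> l \<and> l < h"
  by (auto simp: edges_def)

lemma edge_pair_subgroups:
  assumes "e \<in> edges d h"
  shows "edge_pair h e \<in> subgroup_pairs G"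
proof (cases e)
  case (CC i)
  then have "i \<le> n - 1" "2 * h + 1 - i \<le> n - 1" "i \<le> 2 * h + 1 - i" using assms dh by auto
  then show ?thesis using CC by (simp add: edge_pair_def subgroup_pairs_def C_subgroup C_subset_C)
next
  case (CD i)
  then have "i \<le> n - 1" "2 * h - i \<le> n - 1" "i \<le> 2 * h - i" using assms dh by auto
  then show ?thesis
    using CD by (simp add: edge_pair_def subgroup_pairs_def C_subgroup E_subgroup C_subset_E)
next
  case (CQ i)
  then have "i \<le> n - 1" "2 * h - i \<le> n - 1" "i \<le> 2 * h - i" "1 \<le> 2 * h - i"
    using assms dh h_pos by auto
  then show ?thesis
    using CQ by (simp add: edge_pair_def subgroup_pairs_def C_subgroup E_subgroup C_subset_E)
next
  case (DD l)
  then show ?thesis by (simp add: edge_pair_def subgroup_pairs_def E_subgroup E_mono)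
next
  case (QQ l)
  then have "1 \<le> l" using assms by simp
  then show ?thesis using QQ by (simp add: edge_pair_def subgroup_pairs_def E_subgroup E_mono)
qed

lemma edge_family_edge_pair:
  assumes "e \<in> edges d h"
  shows "edge_family h e (fst (edge_pair h e))" "\<not> edge_family h e (snd (edge_pair h e))"
proof -
  have "edge_family h e (fst (edge_pair h e)) \<and> \<not> edge_family h e (snd (edge_pair h e))"
  proof (cases e)
    case (CC i)
    then have "i \<le> n - 1" "2 * h + 1 - i \<le> n - 1" "\<not> 2 * h + 1 - i \<le> i" using assms dh by auto
    then show ?thesis using CC by (simp add: edge_pair_def edge_family_def C_subset_C)
  next
    case (CD i)
    then have "i \<le> n - 1" "2 * h - i \<le> n - 1" using assms dh by auto
    then show ?thesis
      using CD by (simp add: edge_pair_def edge_family_def C_subset_C C_subset_E has_rfl_E)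
  next
    case (CQ i)
    then have "i \<le> n - 1" "2 * h - i \<le> n - 1" using assms dh by auto
    then show ?thesis
      using CQ by (simp add: edge_pair_def edge_family_def C_subset_C C_subset_E has_rfl_E)
  next
    case (DD l)
    then have "l + 1 \<le> n - 1" using assms dh by auto
    then show ?thesis using DD by (simp add: edge_pair_def edge_family_def C_subset_E has_rfl_E)
  next
    case (QQ l)
    then have "l + 1 \<le> n - 1" using assms dh by auto
    then show ?thesis using QQ by (simp add: edge_pair_def edge_family_def C_subset_E has_rfl_E)
  qed
  then show "edge_family h e (fst (edge_pair h e))" "\<not> edge_family h e (snd (edge_pair h e))" by auto
qed

text \<open>A violating \<open>N\<close> passes what it contains to \<open>M\<close>, and
  \<open>N \<inter> L\<close> to \<open>L\<close>, so only the levels of \<open>f\<close> matter.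
  Among transfers out of cyclic subgroups a larger source has a smaller target. A \<open>DD\<close>
  or \<open>QQ\<close> transfer leads from a level below \<open>h\<close> to one at most
  \<open>h\<close>, too low to cover them, and gains only one level.\<close>

lemma separated_edges:
  assumes "e \<in> edges d h" "f \<in> edges d h" "f \<noteq> e"
  shows "separated (edge_family h e) (edge_pair h f)"
proof -
  obtain L M where LM: "edge_pair h f = (L, M)" by fastforce
  show ?thesis
  proof (cases e)
    case (CC i)
    have "\<not> (C i \<subseteq> L \<and> C (2 * h + 1 - i) \<subseteq> M \<and> \<not> C (2 * h + 1 - i) \<subseteq> L)"
      using assms LM dh h_pos unfolding CC
      by (cases f) (auto simp: edge_pair_def C_subset_C C_subset_E has_rfl_E del: subsetI)
    then show ?thesis unfolding separated_def CC LM by (auto simp: edge_family_def has_rfl_def)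
  next
    case (CD i)
    \<comment> \<open>The whole group has reflections of both kinds, so \<open>CQ 0\<close> would
      break this for \<open>d = 1\<close> and \<open>i = 0\<close>; it is not in
      \<open>edges 1 h\<close>.\<close>
    have "\<not> (C i \<subseteq> L \<and> C (2 * h - i) \<subseteq> M \<and> has_rfl 0 M)"
      using assms LM dh h_pos unfolding CD
      by (cases f) (auto simp: edge_pair_def C_subset_C C_subset_E has_rfl_E del: subsetI)
    then show ?thesis unfolding separated_def CD LM by (auto simp: edge_family_def has_rfl_def)
  next
    case (CQ i)
    have "\<not> (C i \<subseteq> L \<and> C (2 * h - i) \<subseteq> M \<and> has_rfl 1 M)"
      using assms LM dh h_pos unfolding CQ
      by (cases f) (auto simp: edge_pair_def C_subset_C C_subset_E has_rfl_E del: subsetI)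
    then show ?thesis unfolding separated_def CQ LM by (auto simp: edge_family_def has_rfl_def)
  next
    case (DD l)
    have "\<not> (has_rfl 0 L \<and> C (l + 1) \<subseteq> M \<and> \<not> C (l + 1) \<subseteq> L)"
      using assms LM dh h_pos unfolding DD
      by (cases f) (auto simp: edge_pair_def C_subset_C C_subset_E has_rfl_E del: subsetI)
    then show ?thesis unfolding separated_def DD LM by (auto simp: edge_family_def has_rfl_def)
  next
    case (QQ l)
    have "\<not> (has_rfl 1 L \<and> C (l + 1) \<subseteq> M \<and> \<not> C (l + 1) \<subseteq> L)"
      using assms LM dh h_pos unfolding QQ
      by (cases f) (auto simp: edge_pair_def C_subset_C C_subset_E has_rfl_E del: subsetI)
    then show ?thesis unfolding separated_def QQ LM by (auto simp: edge_family_def has_rfl_def)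
  qed
qed

lemma card_edges: "card (edges d h) = 5 * h + 2 - 2 * d"
proof -
  have "card (edges d h) = card (CC ` {d..h}) + card (CD ` {..h}) + card (CQ ` {d..h})
      + card (DD ` {..<h}) + card (QQ ` {1..<h})"
    unfolding edges_def by (subst card_Un_disjoint, force, force, force)+ simp
  also have "\<dots> = (h + 1 - d) + (h + 1) + (h + 1 - d) + h + (h - 1)"
    by (simp add: card_image inj_on_def)
  finally show ?thesis using h_pos dh(2) by simp
qed

lemma card_edges_le_complexity: "5 * h + 2 - 2 * d \<le> complexity G"
proof -
  have "card (edges d h) \<le> complexity G"
  proof (rule card_le_complexity_of_separated[OF finite_carrier, where p = "edge_pair h"])
    fix e assume e: "e \<in> edges d h"
    show "edge_pair h e \<in> subgroup_pairs G" by (rule edge_pair_subgroups[OF e])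
    obtain T where T: "T \<in> Tr G" "edge_pair h e \<notin> T"
        "\<And>f. f \<in> subgroup_pairs G \<Longrightarrow> separated (edge_family h e) f \<Longrightarrow> f \<in> T"
      using separating_transfer_system[OF edge_family_conj edge_pair_subgroups[OF e]
          edge_family_edge_pair[OF e]] by blast
    have "edge_pair h f \<in> T" if "f \<in> edges d h - {e}" for f
      using that separated_edges[OF e] edge_pair_subgroups by (intro T(3)) auto
    then show "\<exists>T \<in> Tr G. edge_pair h e \<notin> T \<and> (\<forall>f \<in> edges d h - {e}. edge_pair h f \<in> T)"
      using T(1,2) by blast
  qed
  then show ?thesis by (simp add: card_edges)
qed

end

lemma complexity_ge: "5 * (n - 1) div 2 \<le> complexity G"
proof (cases "even n")
  case True
  then obtain m where "n = 2 * m" by blast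
  then have "n = 2 * (m - 1) + 2" using n by simp
  then show ?thesis using card_edges_le_complexity[of 0 "m - 1"] by simp
next
  case False
  then obtain m where "n = 2 * m + 1" using oddE by blast
  then show ?thesis using card_edges_le_complexity[of 1 m] by simp
qed

end

section \<open>The presentation of \<open>SD n\<close>\<close>

text \<open>Words act on the integers by affine maps \<open>x \<mapsto> p * x + q\<close>, with \<open>a\<close> acting as \<open>x \<mapsto> x + 1\<close>
  and \<open>b\<close> as \<open>x \<mapsto> r * x\<close>; modulo \<open>2 ^ (n - 1)\<close> the relations of \<open>SD n\<close> are respected.\<close>

fun letter_map :: "int \<Rightarrow> sd_gen \<times> bool \<Rightarrow> int \<times> int" where
  "letter_map r (Gen_a, e) = (1, if e then 1 else - 1)"
| "letter_map r (Gen_b, e) = (r, 0)"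

fun word_map :: "int \<Rightarrow> sd_gen word \<Rightarrow> int \<times> int" where
  "word_map r [] = (1, 0)"
| "word_map r (l # u) = (fst (letter_map r l) * fst (word_map r u),
     snd (letter_map r l) + fst (letter_map r l) * snd (word_map r u))"

lemma word_map_append:
  "word_map r (u @ v) = (fst (word_map r u) * fst (word_map r v),
     snd (word_map r u) + fst (word_map r u) * snd (word_map r v))"
  by (induction u) (simp_all add: algebra_simps)

lemma word_power_letter: "word_power [l] k = replicate k l"
  by (induction k) simp_all

lemma word_map_replicate_a: "word_map r (replicate k (Gen_a, True)) = (1, int k)"
  by (induction k) simp_all

definition SD_relations :: "nat \<Rightarrow> (sd_gen word \<times> sd_gen word) set" where
  "SD_relations n =
     {(word_power word_a (2 ^ (n - 1)), []),
      (word_power word_b 2, []),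
      (word_b @ word_a @ word_b, word_power word_a (2 ^ (n - 2) - 1))}"

text \<open>The affine model keeps the presented group from collapsing: it bounds the order of
  \<open>a\<close> from below and separates \<open>b\<close> from the powers of
  \<open>a\<close>.\<close>

lemma word_map_cong:
  fixes n :: nat
  defines "r \<equiv> 2 ^ (n - 2) - 1 :: int" and "m \<equiv> 2 ^ (n - 1) :: int"
  assumes n: "n \<ge> 4" and "word_eq (SD_relations n) u v"
  shows "[fst (word_map r u) = fst (word_map r v)] (mod m) \<and>
    [snd (word_map r u) = snd (word_map r v)] (mod m)"
proof -
  have r: "[r * r = 1] (mod m)" using semidihedral_unit_square[OF n] by (simp add: r_def m_def cong_iff_dvd_diff)
  show ?thesis using assms(4)
  proof induction
    case (sym u v)
    then show ?case by (simp add: cong_sym_eq)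
  next
    case (trans u v w)
    then show ?case by (meson cong_trans)
  next
    case (append u u' v v')
    then show ?case by (simp add: word_map_append cong_add cong_mult)
  next
    case (cancel x e)
    then show ?case using r by (cases x) auto
  next
    case (relation u v)
    have "[int (2 ^ (n - 1)) = 0] (mod m)" by (simp add: m_def cong_0_iff)
    moreover have "int (2 ^ (n - 2) - 1) = r" by (simp add: r_def of_nat_diff)
    ultimately show ?case using relation r
      by (auto simp: SD_relations_def word_power_letter word_map_replicate_a numeral_2_eq_2)
  qed simp_all
qed

section \<open>Normal forms in the presented group\<close>

text \<open>Moving \<open>b\<close> to the right past \<open>a\<close> or \<open>inv a\<close> turns
  the letter into \<open>a [^] r\<close> or \<open>a [^] (- r)\<close>. This is the induction step
  over the letters of a word.\<close>

lemma (in group) pow_pow_times_cases: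
  fixes r :: int
  assumes a: "a \<in> carrier G" and b: "b \<in> carrier G" and bb: "b \<otimes> b = \<one>"
    and bab: "b \<otimes> a \<otimes> b = a [^] r"
    and g: "\<exists>x::int. g = a [^] x \<or> g = a [^] x \<otimes> b"
    and s: "s \<in> {a, inv a, b}"
  shows "\<exists>x::int. g \<otimes> s = a [^] x \<or> g \<otimes> s = a [^] x \<otimes> b"
proof -
  obtain x :: int where x: "g = a [^] x \<or> g = a [^] x \<otimes> b" using g by blast
  have inv_b: "inv b = b" using bb b by (simp add: inv_equality)
  have bsb: "b \<otimes> a = a [^] r \<otimes> b" "b \<otimes> inv a = a [^] (- r) \<otimes> b"
  proof -
    have "b \<otimes> a = b \<otimes> a \<otimes> b \<otimes> b" using a b bb by (simp add: m_assoc)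
    then show "b \<otimes> a = a [^] r \<otimes> b" by (simp only: bab)
    have "inv (b \<otimes> a \<otimes> b) = b \<otimes> inv a \<otimes> b"
      using a b by (simp add: inv_mult_group inv_b m_assoc)
    then have "b \<otimes> inv a \<otimes> b = a [^] (- r)" using a by (simp add: bab int_pow_neg)
    moreover have "b \<otimes> inv a = b \<otimes> inv a \<otimes> b \<otimes> b" using a b bb by (simp add: m_assoc)
    ultimately show "b \<otimes> inv a = a [^] (- r) \<otimes> b" by simp
  qed
  have "a [^] x \<otimes> a = a [^] (x + 1)" "a [^] x \<otimes> inv a = a [^] (x - 1)"
    using a by (simp_all add: int_pow_mult int_pow_diff)
  moreover have "a [^] x \<otimes> b \<otimes> a = a [^] (x + r) \<otimes> b"
    "a [^] x \<otimes> b \<otimes> inv a = a [^] (x - r) \<otimes> b" "a [^] x \<otimes> b \<otimes> b = a [^] x"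
    using a b bb bsb int_pow_mult[OF a, of x r] int_pow_mult[OF a, of x "- r"]
    by (simp_all add: m_assoc)
  ultimately show ?thesis using x s by blast
qed

lemma semidihedral_SD:
  assumes n: "n \<ge> 4"
  shows "semidihedral (SD n) (word_class (SD_relations n) word_a) (word_class (SD_relations n) word_b) n"
proof -
  let ?R = "SD_relations n" and ?m = "2 ^ (n - 1) :: nat" and ?r = "2 ^ (n - 2) - 1 :: nat"
  let ?a = "word_class ?R word_a" and ?b = "word_class ?R word_b"
  have SD: "SD n = presented_group ?R" by (simp add: SD_def SD_relations_def)
  interpret group "SD n" unfolding SD by (rule presented_group_is_group)
  have carrier: "carrier (SD n) = range (word_class ?R)" and one: "\<one>\<^bsub>SD n\<^esub> = word_class ?R []"
    by (simp_all add: SD presented_group_def)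
  have mult: "word_class ?R u \<otimes>\<^bsub>SD n\<^esub> word_class ?R v = word_class ?R (u @ v)" for u v
    unfolding SD by (rule presented_group_mult)
  have a: "?a \<in> carrier (SD n)" and b: "?b \<in> carrier (SD n)" by (simp_all add: carrier)
  have pow: "?a [^]\<^bsub>SD n\<^esub> k = word_class ?R (replicate k (Gen_a, True))" for k :: nat
  proof (induction k)
    case (Suc k)
    then show ?case by (simp add: mult flip: replicate_append_same)
  qed (simp add: one)
  have eq: "word_class ?R u = word_class ?R v" if "(u, v) \<in> ?R" for u v
    unfolding word_class_eq_iff using that by (rule word_eq.relation)
  have am: "?a [^]\<^bsub>SD n\<^esub> ?m = \<one>\<^bsub>SD n\<^esub>"
    unfolding pow one by (rule eq) (simp add: SD_relations_def word_power_letter)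
  have bb: "?b \<otimes>\<^bsub>SD n\<^esub> ?b = \<one>\<^bsub>SD n\<^esub>"
    unfolding mult one by (rule eq) (simp add: SD_relations_def numeral_2_eq_2)
  have bab: "?b \<otimes>\<^bsub>SD n\<^esub> ?a \<otimes>\<^bsub>SD n\<^esub> ?b = ?a [^]\<^bsub>SD n\<^esub> ?r"
    unfolding mult pow by (rule eq) (simp add: SD_relations_def word_power_letter)
  \<comment> \<open>Nonnegative powers of \<open>a\<close> are represented by explicit words, so
    exponents are reduced before words are compared.\<close>
  have mod: "?a [^]\<^bsub>SD n\<^esub> x = ?a [^]\<^bsub>SD n\<^esub> nat (x mod int ?m)" for x :: int
  proof -
    have "?a [^]\<^bsub>SD n\<^esub> x = ?a [^]\<^bsub>SD n\<^esub> (int ?m * (x div int ?m) + x mod int ?m)" by simp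
    also have "\<dots> = (?a [^]\<^bsub>SD n\<^esub> int ?m) [^]\<^bsub>SD n\<^esub> (x div int ?m) \<otimes>\<^bsub>SD n\<^esub> ?a [^]\<^bsub>SD n\<^esub> (x mod int ?m)"
      using a by (simp only: int_pow_mult int_pow_pow)
    also have "?a [^]\<^bsub>SD n\<^esub> int ?m = \<one>\<^bsub>SD n\<^esub>" using am by (simp only: int_pow_int)
    also have "x mod int ?m = int (nat (x mod int ?m))" by simp
    finally show ?thesis using a by (simp only: int_pow_int int_pow_one nat_pow_closed l_one)
  qed
  show ?thesis
  proof unfold_locales
    show "?a [^]\<^bsub>SD n\<^esub> x = \<one>\<^bsub>SD n\<^esub> \<longleftrightarrow> 2 ^ (n - 1) dvd x" for x :: int
    proof
      assume "?a [^]\<^bsub>SD n\<^esub> x = \<one>\<^bsub>SD n\<^esub>"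
      then have "word_eq ?R (replicate (nat (x mod int ?m)) (Gen_a, True)) []"
        unfolding mod pow one word_class_eq_iff .
      from word_map_cong[OF n this] have "[x mod int ?m = 0] (mod 2 ^ (n - 1))"
        by (simp add: word_map_replicate_a)
      then show "2 ^ (n - 1) dvd x" by (simp add: cong_0_iff dvd_mod_iff)
    next
      assume "2 ^ (n - 1) dvd x"
      then have "nat (x mod int ?m) = 0" by simp
      then show "?a [^]\<^bsub>SD n\<^esub> x = \<one>\<^bsub>SD n\<^esub>" unfolding mod[of x] by simp
    qed
    have "int ?r = 2 ^ (n - 2) - 1" by (simp add: of_nat_diff)
    then show "?b \<otimes>\<^bsub>SD n\<^esub> ?a \<otimes>\<^bsub>SD n\<^esub> ?b = ?a [^]\<^bsub>SD n\<^esub> (2 ^ (n - 2) - 1 :: int)"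
      using bab int_pow_int by metis
    note bab' = this
    show "?b \<noteq> ?a [^]\<^bsub>SD n\<^esub> x" for x :: int
    proof
      assume "?b = ?a [^]\<^bsub>SD n\<^esub> x"
      then have "word_eq ?R word_b (replicate (nat (x mod int ?m)) (Gen_a, True))"
        unfolding mod pow word_class_eq_iff .
      \<comment> \<open>The linear parts are compared: that of \<open>b\<close> is
        \<open>2 ^ (n - 2) - 1\<close>, that of a power of \<open>a\<close> is 1. Their difference
        is positive and less than \<open>2 ^ (n - 1)\<close>.\<close>
      from word_map_cong[OF n this] have "[2 ^ (n - 2) - 1 = 1] (mod (2 ^ (n - 1) :: int))"
        by (simp add: word_map_replicate_a)
      then have "(2::int) ^ (n - 1) dvd 2 ^ (n - 2) - 2" by (simp add: cong_iff_dvd_diff)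
      moreover have "(2::int) ^ 2 \<le> 2 ^ (n - 2)" using n by (intro power_increasing) auto
      ultimately have "(2::int) ^ (n - 1) \<le> 2 ^ (n - 2) - 2" by (intro zdvd_imp_le) auto
      moreover have "(2::int) ^ (n - 2) \<le> 2 ^ (n - 1)" by (intro power_increasing) auto
      ultimately show False by linarith
    qed
    show "\<exists>x::int. g = ?a [^]\<^bsub>SD n\<^esub> x \<or> g = ?a [^]\<^bsub>SD n\<^esub> x \<otimes>\<^bsub>SD n\<^esub> ?b" if "g \<in> carrier (SD n)" for g
    proof -
      obtain u where u: "g = word_class ?R u" using \<open>g \<in> carrier (SD n)\<close> carrier by blast
      have "\<exists>x::int. word_class ?R u = ?a [^]\<^bsub>SD n\<^esub> x \<or> word_class ?R u = ?a [^]\<^bsub>SD n\<^esub> x \<otimes>\<^bsub>SD n\<^esub> ?b"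
      proof (induction u rule: rev_induct)
        case Nil
        have "word_class ?R [] = ?a [^]\<^bsub>SD n\<^esub> (0::int)" by (simp flip: one)
        then show ?case by blast
      next
        case (snoc l u)
        have inv: "word_class ?R [(c, False)] = inv\<^bsub>SD n\<^esub> word_class ?R [(c, True)]" for c
        proof (rule inv_equality[symmetric])
          show "word_class ?R [(c, False)] \<otimes>\<^bsub>SD n\<^esub> word_class ?R [(c, True)] = \<one>\<^bsub>SD n\<^esub>"
            using word_eq.cancel[of ?R c False] by (simp add: mult one word_class_eq_iff)
        qed (simp_all add: carrier)
        have "inv\<^bsub>SD n\<^esub> ?b = ?b" using bb b by (simp add: inv_equality)
        moreover obtain c e where "l = (c, e)" by fastforce
        ultimately have "word_class ?R [l] \<in> {?a, inv\<^bsub>SD n\<^esub> ?a, ?b}"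
          using inv by (cases c; cases e) auto
        from pow_pow_times_cases[OF a b bb bab' snoc.IH this] show ?case by (simp add: mult)
      qed
      then show ?thesis by (simp add: u)
    qed
  qed (fact n a b bb)+
qed

theorem theoremE:
  fixes n :: nat
  assumes "n \<ge> 4"
  shows "int (complexity (SD n)) \<ge> \<lfloor>5 * (real n - 1) / 2\<rfloor> \<and>
    (\<forall>m::nat. n = 2 * m \<longrightarrow> \<lfloor>5 * (real n - 1) / 2\<rfloor> = 5 * int m - 3) \<and>
    (\<forall>m::nat. n = 2 * m + 1 \<longrightarrow> \<lfloor>5 * (real n - 1) / 2\<rfloor> = 5 * int m)"
proof (intro conjI allI impI)
  have "\<lfloor>5 * (real n - 1) / 2\<rfloor> = \<lfloor>real (5 * (n - 1)) / real 2\<rfloor>"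
    using assms by (simp add: of_nat_diff)
  also have "\<dots> = int (5 * (n - 1) div 2)" by (rule floor_divide_of_nat_eq)
  also have "\<dots> \<le> int (complexity (SD n))"
    using semidihedral.complexity_ge[OF semidihedral_SD[OF assms]] by simp
  finally show "\<lfloor>5 * (real n - 1) / 2\<rfloor> \<le> int (complexity (SD n))" .
next
  fix m assume "n = 2 * m"
  then show "\<lfloor>5 * (real n - 1) / 2\<rfloor> = 5 * int m - 3" by (simp add: floor_eq_iff)
next
  fix m assume "n = 2 * m + 1"
  then show "\<lfloor>5 * (real n - 1) / 2\<rfloor> = 5 * int m" by (simp add: floor_eq_iff)
qed

end
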